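(* Consider the Markov decision process (MDP) with a reachability objective with state space $S=\{x,y,z,s^*\}$, target state $s^*$, initial state $x$, and the following actions and transitions. In state $x$ there are two actions $a$ and $b$: action $a$ leads to $s^*$ with probability $\frac12$ and to $x$ with probability $\frac12$; action $b$ leads to $s^*$ with probability $\frac34$ and to $y$ with probability $\frac14$. In state $y$ there is a single action $d$, which leads to $z$ with probability 1. In state $z$ there is a single action $e$, which leads to $s^*$ with probability $\frac12$ and to $z$ with probability $\frac12$. State $s^*$ is absorbing. In this MDP there exists no overtaking optimal strategy (at the initial state $x$).
   Context: Play runs over periods $1,2,3,\ldots$, starting at period 1 in the initial state $s_1=x$; at each period $t$ the decision maker chooses an action $a_t$ available in the current state $s_t$ and $s_{t+1}$ is drawn according to the transition probabilities of $(s_t,a_t)$. A strategy $\sigma$ assigns to each finite history $(s_1,a_1,\ldots,s_{t-1},a_{t-1},s_t)$ (with all transitions having positive probability) a probability distribution on the actions available in $s_t$; randomization and history dependence are allowed. $\mathbb{P}_{s\sigma}$ denotes the probability measure on infinite histories induced by initial state $s$ and strategy $\sigma$. Let $t^*$ be the first period at which the state is $s^*$ ($t^*=\infty$ if $s^*$ is never reached). A strategy $\sigma$ overtakes a strategy $\sigma'$ at the initial state $s$ if there is $T\in\mathbb{N}$ such that $\mathbb{P}_{s\sigma}(t^*\leq t)>\mathbb{P}_{s\sigma'}(t^*\leq t)$ for all $t\geq T$. A strategy is overtaking optimal at $s$ if no strategy overtakes it at $s$. *)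

theory Defs
  imports "HOL-Probability.Probability"
begin

section \<open>Markov decision processes with a reachability objective\<close>

text \<open>The distribution \<^term>\<open>transition M s a\<close> is only meaningful for \<^term>\<open>a \<in> acts M s\<close>.\<close>

record ('s, 'a) mdp =
  acts :: "'s \<Rightarrow> 'a set"
  transition :: "'s \<Rightarrow> 'a \<Rightarrow> 's pmf"
  target :: 's

definition wf_mdp :: "('s, 'a) mdp \<Rightarrow> bool" where
  "wf_mdp M \<longleftrightarrow>
     (\<forall>s. acts M s \<noteq> {} \<and> finite (acts M s)) \<and>
     (\<forall>a\<in>acts M (target M). transition M (target M) a = return_pmf (target M))"

text \<open>\<^term>\<open>history M h s\<close> says that the past state-action pairs \<^term>\<open>h\<close> followed by the
  current state \<^term>\<open>s\<close> form a finite history.\<close>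

inductive history :: "('s, 'a) mdp \<Rightarrow> ('s \<times> 'a) list \<Rightarrow> 's \<Rightarrow> bool" for M where
  start: "history M [] s"
| step: "history M h s \<Longrightarrow> a \<in> acts M s \<Longrightarrow> s' \<in> set_pmf (transition M s a) \<Longrightarrow>
           history M (h @ [(s, a)]) s'"

text \<open>A strategy is represented by a total function; its values outside of histories are
  irrelevant and unconstrained.\<close>

type_synonym ('s, 'a) strategy = "('s \<times> 'a) list \<Rightarrow> 's \<Rightarrow> 'a pmf"

definition is_strategy :: "('s, 'a) mdp \<Rightarrow> ('s, 'a) strategy \<Rightarrow> bool" where
  "is_strategy M \<sigma> \<longleftrightarrow> (\<forall>h s. history M h s \<longrightarrow> set_pmf (\<sigma> h s) \<subseteq> acts M s)"

section \<open>The probability measure on infinite histories\<close>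

text \<open>An infinite history is a function \<^term>\<open>\<omega> :: nat \<Rightarrow> 's \<times> 'a\<close> where \<^term>\<open>\<omega> i\<close> is
  the state-action pair of period \<^term>\<open>Suc i\<close>; play starts at period 1.
  \<^term>\<open>step_pmf M s \<sigma> i \<omega>\<close> is the conditional distribution of \<^term>\<open>\<omega> i\<close> given the
  earlier pairs.\<close>

fun step_pmf :: "('s, 'a) mdp \<Rightarrow> 's \<Rightarrow> ('s, 'a) strategy \<Rightarrow> nat \<Rightarrow> (nat \<Rightarrow> 's \<times> 'a) \<Rightarrow> ('s \<times> 'a) pmf"
where
  "step_pmf M s \<sigma> 0 \<omega> = map_pmf (\<lambda>a. (s, a)) (\<sigma> [] s)"
| "step_pmf M s \<sigma> (Suc n) \<omega> =
     bind_pmf (transition M (fst (\<omega> n)) (snd (\<omega> n)))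
       (\<lambda>s'. map_pmf (\<lambda>a. (s', a)) (\<sigma> (map \<omega> [0..<Suc n]) s'))"

definition step_kernel ::
  "('s, 'a) mdp \<Rightarrow> 's \<Rightarrow> ('s, 'a) strategy \<Rightarrow> nat \<Rightarrow> (nat \<Rightarrow> 's \<times> 'a) \<Rightarrow> ('s \<times> 'a) measure"
where
  "step_kernel M s \<sigma> n \<omega> = measure_pmf (step_pmf M s \<sigma> n \<omega>)"

lemma step_pmf_cong:
  assumes "\<And>i. i < n \<Longrightarrow> \<omega> i = \<omega>' i"
  shows "step_pmf M s \<sigma> n \<omega> = step_pmf M s \<sigma> n \<omega>'"
proof (cases n)
  case (Suc m)
  then have "map \<omega> [0..<Suc m] = map \<omega>' [0..<Suc m]" "\<omega> m = \<omega>' m"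
    using assms Suc by (auto intro!: map_cong simp del: upt_Suc)
  with Suc show ?thesis by (simp only: step_pmf.simps)
qed simp

lemma Ionescu_Tulcea_step_kernel:
  fixes M :: "('s::countable, 'a::countable) mdp"
  shows "Ionescu_Tulcea (step_kernel M s \<sigma>) (\<lambda>_. count_space UNIV)"
proof (rule Ionescu_Tulcea.intro)
  fix n :: nat
  let ?P = "PiM {0..<n} (\<lambda>_. count_space (UNIV :: ('s \<times> 'a) set))"
  have "(\<lambda>\<omega>. map \<omega> [0..<k]) \<in> measurable ?P (count_space UNIV)" if "k \<le> n" for k
    using that
  proof (induction k)
    case (Suc k)
    then have [measurable]: "(\<lambda>\<omega>. map \<omega> [0..<k]) \<in> measurable ?P (count_space UNIV)"
      and [measurable]: "(\<lambda>\<omega>. \<omega> k) \<in> measurable ?P (count_space UNIV)"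
      by (auto intro!: measurable_component_singleton)
    have "(\<lambda>\<omega>. map \<omega> [0..<k] @ [\<omega> k]) \<in> measurable ?P (count_space UNIV)"
      by measurable
    then show ?case by simp
  qed simp
  then have m: "(\<lambda>\<omega>. map \<omega> [0..<n]) \<in> measurable ?P (count_space UNIV)"
    by simp
  have eq: "step_kernel M s \<sigma> n = (\<lambda>h. step_kernel M s \<sigma> n (nth h)) \<circ> (\<lambda>\<omega>. map \<omega> [0..<n])"
    by (auto simp: fun_eq_iff step_kernel_def intro!: arg_cong[where f=measure_pmf] step_pmf_cong)
  have "(\<lambda>h. step_kernel M s \<sigma> n (nth h))
      \<in> measurable (count_space UNIV) (subprob_algebra (count_space UNIV))"
    by (auto simp: step_kernel_def intro!: measure_pmf_in_subprob_algebra)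
  then show "step_kernel M s \<sigma> n \<in> measurable ?P (subprob_algebra (count_space UNIV))"
    by (subst eq) (rule measurable_comp[OF m])
qed (simp add: step_kernel_def measure_pmf.prob_space_axioms)

text \<open>The projective limit of the finite-horizon distributions generated by the kernels.\<close>

definition play_measure ::
  "('s::countable, 'a::countable) mdp \<Rightarrow> 's \<Rightarrow> ('s, 'a) strategy \<Rightarrow> (nat \<Rightarrow> 's \<times> 'a) measure"
where
  "play_measure M s \<sigma> =
     projective_family.lim UNIV
       (Ionescu_Tulcea.CI (step_kernel M s \<sigma>) (\<lambda>_. count_space UNIV)) (\<lambda>_. count_space UNIV)"

lemma space_play_measure [simp]: "space (play_measure M s \<sigma>) = UNIV"
  and sets_play_measure [simp, measurable_cong]:
    "sets (play_measure M s \<sigma>) = sets (PiM UNIV (\<lambda>_. count_space UNIV))"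
  and prob_space_play_measure: "prob_space (play_measure M s \<sigma>)"
proof -
  interpret IT: Ionescu_Tulcea "step_kernel M s \<sigma>" "\<lambda>_. count_space UNIV"
    by (rule Ionescu_Tulcea_step_kernel)
  show sp: "space (play_measure M s \<sigma>) = UNIV"
    by (simp add: play_measure_def space_PiM)
  show "sets (play_measure M s \<sigma>) = sets (PiM UNIV (\<lambda>_. count_space UNIV))"
    by (simp add: play_measure_def)
  have "emeasure IT.PF.lim (IT.PF.emb UNIV {} {\<lambda>_. undefined}) = emeasure (IT.CI {}) {\<lambda>_. undefined}"
    by (rule IT.lim) (auto simp: PiM_empty)
  also have "\<dots> = 1"
    using prob_space.emeasure_space_1[OF IT.PF.prob_space_P[of "{}"]]
    by (simp add: IT.PF.space_P space_PiM)
  also have "IT.PF.emb UNIV {} {\<lambda>_. undefined} = UNIV"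
    by (auto simp: prod_emb_def space_PiM restrict_def)
  finally show "prob_space (play_measure M s \<sigma>)"
    by (intro prob_spaceI) (simp add: sp, simp add: play_measure_def)
qed

text \<open>Cylinder probabilities; together with \<open>prob_space_play_measure\<close> (the case of the empty
  cylinder) this determines the measure.\<close>

lemma emeasure_play_measure_cylinder:
  "emeasure (play_measure M s \<sigma>) {\<omega>. \<forall>i<Suc n. \<omega> i = f i} =
     emeasure (play_measure M s \<sigma>) {\<omega>. \<forall>i<n. \<omega> i = f i} * ennreal (pmf (step_pmf M s \<sigma> n f) (f n))"
proof -
  interpret IT: Ionescu_Tulcea "step_kernel M s \<sigma>" "\<lambda>_. count_space UNIV"
    by (rule Ionescu_Tulcea_step_kernel)
  let ?r = "\<lambda>k. restrict f {0..<k}"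
  let ?u = "\<lambda>_::nat. undefined"
  let ?P = "\<lambda>k. PiM {0..<k} (\<lambda>_. count_space UNIV) :: (nat \<Rightarrow> 'a \<times> 'b) measure"
  have r: "{?r k} \<in> sets (?P k)" for k
  proof -
    have "PiE {0..<k} (\<lambda>i. {f i}) = {?r k}"
      by (auto simp: PiE_def Pi_def extensional_def restrict_def fun_eq_iff)
    then show ?thesis
      by (metis finite_atLeastLessThan sets_PiM_I_finite sets_count_space Pow_UNIV UNIV_I)
  qed
  have u: "?u \<in> space (?P 0)" by (simp add: space_PiM)
  have cyl: "emeasure (play_measure M s \<sigma>) {\<omega>. \<forall>i<k. \<omega> i = f i} = emeasure (IT.C 0 k ?u) {?r k}" for k
  proof -
    have "restrict \<omega> {0..<k} = ?r k \<longleftrightarrow> (\<forall>i<k. \<omega> i = f i)" for \<omega>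
    proof
      assume eq: "restrict \<omega> {0..<k} = ?r k"
      show "\<forall>i<k. \<omega> i = f i"
      proof safe
        fix i assume "i < k"
        then show "\<omega> i = f i" using fun_cong[OF eq, of i] by simp
      qed
    qed (auto intro!: restrict_ext)
    then have "{\<omega>. \<forall>i<k. \<omega> i = f i} = IT.PF.emb UNIV {0..<k} {?r k}"
      by (simp add: prod_emb_def space_PiM vimage_def)
    then have "emeasure (play_measure M s \<sigma>) {\<omega>. \<forall>i<k. \<omega> i = f i} = emeasure (IT.CI {0..<k}) {?r k}"
      using IT.lim[of "{0..<k}", OF _ r] by (simp add: play_measure_def)
    also have "\<dots> = emeasure (IT.C 0 k ?u) (IT.PF.emb {0..<k} {0..<k} {?r k})"
      by (rule IT.emeasure_CI[OF _ r]) simp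
    also have "IT.PF.emb {0..<k} {0..<k} {?r k} = {?r k}"
      using r[of k, THEN sets.sets_into_space] by (intro prod_emb_id) (simp add: space_PiM)
    finally show ?thesis .
  qed
  have "emeasure (IT.C 0 (Suc n) ?u) {?r (Suc n)}
      = (\<integral>\<^sup>+\<omega>. emeasure (IT.eP n \<omega>) {?r (Suc n)} \<partial>IT.C 0 n ?u)"
    using IT.measurable_eP[of n] r[of "Suc n"] u
    by (auto simp: IT.space_C space_PiM PiE_eq_empty_iff measurable_cong_sets[OF IT.sets_C[OF u] refl]
        intro!: emeasure_bind[where N="?P (Suc n)"])
  also have "\<dots> = (\<integral>\<^sup>+\<omega>. ennreal (pmf (step_pmf M s \<sigma> n f) (f n)) * indicator {?r n} \<omega> \<partial>IT.C 0 n ?u)"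
  proof (rule nn_integral_cong)
    fix \<omega> assume "\<omega> \<in> space (IT.C 0 n ?u)"
    then have \<omega>: "\<omega> \<in> space (?P n)"
      using IT.space_C[OF u, of n] by simp
    have "emeasure (IT.eP n \<omega>) {?r (Suc n)} = emeasure (step_kernel M s \<sigma> n \<omega>) (fun_upd \<omega> n -` {?r (Suc n)})"
      using IT.emeasure_eP[OF \<omega> r[of "Suc n"]] by simp
    also have "fun_upd \<omega> n -` {?r (Suc n)} = (if \<omega> = ?r n then {f n} else {})"
    proof -
      have ext: "\<omega> i = undefined" if "\<not> i < n" for i
        using \<omega> that by (auto simp: space_PiM PiE_def extensional_def)
      have "fun_upd \<omega> n x = ?r (Suc n) \<longleftrightarrow> \<omega> = ?r n \<and> x = f n" for x
      proof
        assume eq: "fun_upd \<omega> n x = ?r (Suc n)"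
        have "\<omega> i = ?r n i" for i
          using fun_cong[OF eq, of i] ext[of i] by (cases "i < n") auto
        then show "\<omega> = ?r n \<and> x = f n"
          using fun_cong[OF eq, of n] by auto
      next
        assume "\<omega> = ?r n \<and> x = f n"
        then show "fun_upd \<omega> n x = ?r (Suc n)"
          by (simp add: restrict_upd atLeastLessThanSuc)
      qed
      then show ?thesis by auto
    qed
    also have "emeasure (step_kernel M s \<sigma> n \<omega>) \<dots> =
        ennreal (pmf (step_pmf M s \<sigma> n f) (f n)) * indicator {?r n} \<omega>"
      using step_pmf_cong[of n "?r n" f M s \<sigma>]
      by (auto simp: step_kernel_def emeasure_pmf_single)
    finally show "emeasure (IT.eP n \<omega>) {?r (Suc n)} =
        ennreal (pmf (step_pmf M s \<sigma> n f) (f n)) * indicator {?r n} \<omega>" .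
  qed
  also have "\<dots> = ennreal (pmf (step_pmf M s \<sigma> n f) (f n)) * emeasure (IT.C 0 n ?u) {?r n}"
    using r[of n] IT.sets_C[OF u, of n] by (intro nn_integral_cmult_indicator) simp
  finally show ?thesis
    by (simp only: cyl mult.commute)
qed

section \<open>Overtaking optimality\<close>

text \<open>The first period at which the state is the target.\<close>

definition hitting_time :: "('s, 'a) mdp \<Rightarrow> (nat \<Rightarrow> 's \<times> 'a) \<Rightarrow> enat" where
  "hitting_time M \<omega> = Inf {enat (Suc i) | i. fst (\<omega> i) = target M}"

lemma sets_hitting_time_le:
  fixes M :: "('s::countable, 'a::countable) mdp"
  shows "{\<omega>. hitting_time M \<omega> \<le> enat t} \<in> sets (play_measure M s \<sigma>)"
proof -
  have "hitting_time M \<omega> \<le> enat t \<longleftrightarrow> (\<exists>i<t. fst (\<omega> i) = target M)" for \<omega> :: "nat \<Rightarrow> 's \<times> 'a"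
  proof
    assume *: "hitting_time M \<omega> \<le> enat t"
    then have "{enat (Suc i) | i. fst (\<omega> i) = target M} \<noteq> {}"
      unfolding hitting_time_def by (intro notI) (simp only: Inf_enat_def, simp)
    then have "hitting_time M \<omega> \<in> {enat (Suc i) | i. fst (\<omega> i) = target M}"
      unfolding hitting_time_def by (metis (no_types, lifting) wellorder_InfI ex_in_conv)
    then obtain i where i: "hitting_time M \<omega> = enat (Suc i)" "fst (\<omega> i) = target M"
      by blast
    with * have "i < t"
      by simp
    with i show "\<exists>i<t. fst (\<omega> i) = target M"
      by blast
  next
    assume "\<exists>i<t. fst (\<omega> i) = target M"
    then obtain i where "i < t" "fst (\<omega> i) = target M" by blast
    then have "hitting_time M \<omega> \<le> enat (Suc i)"
      unfolding hitting_time_def by (intro Inf_lower) auto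
    also have "\<dots> \<le> enat t" using \<open>i < t\<close> by simp
    finally show "hitting_time M \<omega> \<le> enat t" .
  qed
  then have "{\<omega>. hitting_time M \<omega> \<le> enat t} =
      (\<Union>i<t. (\<lambda>\<omega>. \<omega> i) -` {p. fst p = target M} \<inter>
        space (PiM UNIV (\<lambda>_. count_space (UNIV :: ('s \<times> 'a) set))))"
    by (auto simp: space_PiM)
  also have "\<dots> \<in> sets (PiM UNIV (\<lambda>_. count_space UNIV))"
    by (intro sets.finite_UN measurable_sets[OF measurable_component_singleton]) auto
  finally show ?thesis
    by simp
qed

definition overtakes ::
  "('s::countable, 'a::countable) mdp \<Rightarrow> 's \<Rightarrow> ('s, 'a) strategy \<Rightarrow> ('s, 'a) strategy \<Rightarrow> bool"
where
  "overtakes M s \<sigma> \<sigma>' \<longleftrightarrow>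
     (\<exists>T::nat. \<forall>t\<ge>T.
        measure (play_measure M s \<sigma>) {\<omega>. hitting_time M \<omega> \<le> enat t}
        > measure (play_measure M s \<sigma>') {\<omega>. hitting_time M \<omega> \<le> enat t})"

definition overtaking_optimal ::
  "('s::countable, 'a::countable) mdp \<Rightarrow> 's \<Rightarrow> ('s, 'a) strategy \<Rightarrow> bool"
where
  "overtaking_optimal M s \<sigma> \<longleftrightarrow>
     is_strategy M \<sigma> \<and> \<not> (\<exists>\<sigma>'. is_strategy M \<sigma>' \<and> overtakes M s \<sigma>' \<sigma>)"

section \<open>The example\<close>

datatype state = St_x | St_y | St_z | St_star
datatype action = Act_a | Act_b | Act_d | Act_e | Act_stay

instance state :: countable by countable_datatype
instance action :: countable by countable_datatype

fun example_acts :: "state \<Rightarrow> action set" where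
  "example_acts St_x = {Act_a, Act_b}"
| "example_acts St_y = {Act_d}"
| "example_acts St_z = {Act_e}"
| "example_acts St_star = {Act_stay}"

text \<open>The last equation covers the absorbing state, and the pairs of a state and an action not
  available in it.\<close>

fun example_transition :: "state \<Rightarrow> action \<Rightarrow> state pmf" where
  "example_transition St_x Act_a = map_pmf (\<lambda>c. if c then St_star else St_x) (bernoulli_pmf (1/2))"
| "example_transition St_x Act_b = map_pmf (\<lambda>c. if c then St_star else St_y) (bernoulli_pmf (3/4))"
| "example_transition St_y Act_d = return_pmf St_z"
| "example_transition St_z Act_e = map_pmf (\<lambda>c. if c then St_star else St_z) (bernoulli_pmf (1/2))"
| "example_transition s _ = return_pmf s"

definition example_mdp :: "(state, action) mdp" where
  "example_mdp = \<lparr>acts = example_acts, transition = example_transition, target = St_star\<rparr>"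

lemma wf_example_mdp: "wf_mdp example_mdp"
proof -
  have "example_acts s \<noteq> {} \<and> finite (example_acts s)" for s
    by (cases s) auto
  then show ?thesis by (simp add: wf_mdp_def example_mdp_def)
qed

end

theory Submission
  imports Defs
begin

text \<open>After \<open>b\<close> play is forced, so up to null events the target is missed only along plays
  \<open>a \<dots> a b d e e \<dots>\<close>, determined by the index at which \<open>b\<close> is chosen. Missing the target
  for \<open>n + 2\<close> periods has the same probability \<open>1 / 2 ^ (n + 1)\<close> for all these plays, except that
  it is halved when \<open>b\<close> is chosen at index \<open>n\<close>. Hence with weights \<open>r n\<close> on the index of \<open>b\<close>
  the probability of a miss is \<open>(1 - r n / 2) / 2 ^ (n + 1)\<close>. As the weights have sum at most 1,
  one can drop finitely many of them and spend the mass gained on strictly increasing all the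
  others; the resulting strategy overtakes the given one.\<close>

section \<open>Cylinders, supported plays and hitting times in a general MDP\<close>

lemma sets_cylinder:
  "{\<omega>. \<forall>i<n. \<omega> i = f i} \<in> sets (play_measure M s \<sigma>)"
proof -
  have "{\<omega> \<in> space (PiM UNIV (\<lambda>_. count_space UNIV)). \<forall>i\<in>{..<n}. \<omega> i = f i}
      \<in> sets (PiM UNIV (\<lambda>_. count_space UNIV))"
    by (intro sets.sets_Collect_finite_All) (auto intro!: sets_Collect_single)
  then show ?thesis
    by (simp add: space_PiM Ball_def)
qed

lemma measure_cylinder_Suc:
  "measure (play_measure M s \<sigma>) {\<omega>. \<forall>i<Suc n. \<omega> i = f i} =
     measure (play_measure M s \<sigma>) {\<omega>. \<forall>i<n. \<omega> i = f i} * pmf (step_pmf M s \<sigma> n f) (f n)"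
  unfolding measure_def emeasure_play_measure_cylinder by (simp add: enn2real_mult)

lemma measure_cylinder_0: "measure (play_measure M s \<sigma>) {\<omega>. \<forall>i<0. \<omega> i = f i} = 1"
  using prob_space.prob_space[OF prob_space_play_measure[of M s \<sigma>]] by simp

text \<open>For fixed \<open>n\<close> the exceptional plays are covered by cylinders indexed by
  lists of length \<open>Suc n\<close>. There are countably many of these, and each is null because
  its last factor in the cylinder formula is 0.\<close>

lemma AE_step_support: "AE \<omega> in play_measure M s \<sigma>. \<forall>n. \<omega> n \<in> set_pmf (step_pmf M s \<sigma> n \<omega>)"
proof (subst AE_all_countable, intro allI)
  fix n
  let ?L = "{l. length l = Suc n \<and> l ! n \<notin> set_pmf (step_pmf M s \<sigma> n (nth l))}"
  let ?C = "\<lambda>l. {\<omega>. \<forall>i<Suc n. \<omega> i = l ! i}"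
  have "?C l \<in> null_sets (play_measure M s \<sigma>)" if "l \<in> ?L" for l
    using that sets_cylinder[of "Suc n" "nth l"]
    by (intro null_setsI) (simp_all add: emeasure_play_measure_cylinder set_pmf_iff)
  then have null: "(\<Union>l\<in>?L. ?C l) \<in> null_sets (play_measure M s \<sigma>)"
    by (intro null_sets_UN') auto
  have "\<omega> \<in> (\<Union>l\<in>?L. ?C l)" if "\<omega> n \<notin> set_pmf (step_pmf M s \<sigma> n \<omega>)" for \<omega>
  proof (rule UN_I)
    have "step_pmf M s \<sigma> n (nth (map \<omega> [0..<Suc n])) = step_pmf M s \<sigma> n \<omega>"
      by (rule step_pmf_cong) (simp add: nth_append del: upt_Suc)
    then show "map \<omega> [0..<Suc n] \<in> ?L"
      using that by (simp del: upt_Suc)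
    show "\<omega> \<in> ?C (map \<omega> [0..<Suc n])"
      by (simp del: upt_Suc)
  qed
  then show "AE \<omega> in play_measure M s \<sigma>. \<omega> n \<in> set_pmf (step_pmf M s \<sigma> n \<omega>)"
    by (intro AE_I'[OF null]) auto
qed

text \<open>\<open>is_strategy\<close> constrains \<sigma> only on histories, so that prefixes are
  histories and that actions are available must be proved together: each extends the other by one
  period.\<close>

lemma history_of_supported_play:
  assumes "is_strategy M \<sigma>" and supp: "\<And>n. \<omega> n \<in> set_pmf (step_pmf M s \<sigma> n \<omega>)"
  shows "history M (map \<omega> [0..<n]) (fst (\<omega> n)) \<and> snd (\<omega> n) \<in> acts M (fst (\<omega> n))"
proof (induction n)
  case 0
  then show ?case
    using supp[of 0] assms(1) history.start[of M s] by (fastforce simp: is_strategy_def)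
next
  case (Suc n)
  obtain a where a: "a \<in> set_pmf (\<sigma> (map \<omega> [0..<Suc n]) (fst (\<omega> (Suc n))))"
      "\<omega> (Suc n) = (fst (\<omega> (Suc n)), a)"
    and s': "fst (\<omega> (Suc n)) \<in> set_pmf (transition M (fst (\<omega> n)) (snd (\<omega> n)))"
    using supp[of "Suc n"] by auto
  have "history M (map \<omega> [0..<Suc n]) (fst (\<omega> (Suc n)))"
    using history.step[OF conjunct1[OF Suc.IH] conjunct2[OF Suc.IH] s'] by simp
  then show ?case
    using assms(1) a unfolding is_strategy_def by (metis snd_conv subsetD)
qed

lemma pmf_step_pmf_Suc:
  "pmf (step_pmf M s \<sigma> (Suc n) \<omega>) (s', a) =
     pmf (transition M (fst (\<omega> n)) (snd (\<omega> n))) s' * pmf (\<sigma> (map \<omega> [0..<Suc n]) s') a"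
proof -
  have *: "pmf (map_pmf (\<lambda>a. (u, a)) p) (s', a) = (if u = s' then pmf p a else 0)" for u p
    by (cases "u = s'") (auto simp: pmf_map_inj' inj_on_def pmf_eq_0_set_pmf)
  have "pmf (step_pmf M s \<sigma> (Suc n) \<omega>) (s', a) =
      measure_pmf.expectation (transition M (fst (\<omega> n)) (snd (\<omega> n)))
        (\<lambda>u. indicator {s'} u * pmf (\<sigma> (map \<omega> [0..<Suc n]) s') a)"
    unfolding step_pmf.simps pmf_bind *
    by (intro Bochner_Integration.integral_cong) (simp_all add: indicator_def)
  also have "\<dots> = measure_pmf.expectation (transition M (fst (\<omega> n)) (snd (\<omega> n))) (indicator {s'}) *
      pmf (\<sigma> (map \<omega> [0..<Suc n]) s') a"
    by (rule integral_mult_left_zero)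
  finally show ?thesis
    by (simp add: measure_pmf_single del: upt_Suc step_pmf.simps)
qed

lemma hitting_time_le_iff: "hitting_time M \<omega> \<le> enat t \<longleftrightarrow> (\<exists>i<t. fst (\<omega> i) = target M)"
proof -
  have "hitting_time M \<omega> \<le> enat t \<longleftrightarrow> hitting_time M \<omega> < enat (Suc t)"
    by (cases "hitting_time M \<omega>") auto
  also have "\<dots> \<longleftrightarrow> (\<exists>i<t. fst (\<omega> i) = target M)"
    unfolding hitting_time_def Inf_less_iff by auto
  finally show ?thesis .
qed

section \<open>Target-avoiding plays of the example\<close>

text \<open>The only play that chooses \<open>b\<close> at index \<open>j\<close> and avoids the target. For \<open>n \<le> j\<close> its first
  \<open>n\<close> entries are those of the play that always chooses \<open>a\<close>.\<close>

definition unhit_play :: "nat \<Rightarrow> nat \<Rightarrow> state \<times> action" where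
  "unhit_play j i = (if i < j then (St_x, Act_a) else if i = j then (St_x, Act_b)
     else if i = Suc j then (St_y, Act_d) else (St_z, Act_e))"

lemma pmf_transition_example [simp]:
  "pmf (example_transition St_x Act_a) St_x = 1/2"
  "pmf (example_transition St_x Act_b) St_y = 1/4"
  "pmf (example_transition St_y Act_d) St_z = 1"
  "pmf (example_transition St_z Act_e) St_z = 1/2"
proof -
  have *: "pmf (map_pmf (\<lambda>c. if c then St_star else u) (bernoulli_pmf p)) u = 1 - p"
    if "0 \<le> p" "p \<le> 1" "u \<noteq> St_star" for u p
  proof -
    have "(\<lambda>c. if c then St_star else u) -` {u} = {False}"
      using that by auto
    then show ?thesis
      using that by (simp add: pmf_map measure_pmf_single)
  qed
  show "pmf (example_transition St_x Act_a) St_x = 1/2"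
    "pmf (example_transition St_x Act_b) St_y = 1/4"
    "pmf (example_transition St_z Act_e) St_z = 1/2"
    by (simp_all add: *)
qed simp

text \<open>Needed to apply \<open>is_strategy\<close> along these plays; every transition they use
  has positive probability.\<close>

lemma history_unhit_play: "history example_mdp (map (unhit_play j) [0..<n]) (fst (unhit_play j n))"
proof (induction n)
  case 0
  then show ?case by (simp add: history.start)
next
  case (Suc n)
  have "snd (unhit_play j n) \<in> acts example_mdp (fst (unhit_play j n))"
    by (simp add: unhit_play_def example_mdp_def)
  moreover have "fst (unhit_play j (Suc n)) \<in>
      set_pmf (transition example_mdp (fst (unhit_play j n)) (snd (unhit_play j n)))"
    by (auto simp: unhit_play_def example_mdp_def set_pmf_iff simp del: example_transition.simps)
  ultimately show ?case
    using history.step[OF Suc.IH] by fastforce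
qed

definition b_prob :: "(state, action) strategy \<Rightarrow> nat \<Rightarrow> real" where
  "b_prob \<sigma> n = pmf (\<sigma> (replicate n (St_x, Act_a)) St_x) Act_b"

text \<open>Probability of choosing \<open>b\<close> for the first time at index \<open>n\<close>, conditional on action \<open>a\<close>
  always leading back to \<open>x\<close>.\<close>

definition first_b_prob :: "(state, action) strategy \<Rightarrow> nat \<Rightarrow> real" where
  "first_b_prob \<sigma> n = b_prob \<sigma> n * (\<Prod>i<n. 1 - b_prob \<sigma> i)"

lemma sum_first_b_prob: "(\<Sum>i<n. first_b_prob \<sigma> i) = 1 - (\<Prod>i<n. 1 - b_prob \<sigma> i)"
  by (induction n) (auto simp: first_b_prob_def algebra_simps)

lemma b_prob_bounds: "0 \<le> b_prob \<sigma> n" "b_prob \<sigma> n \<le> 1"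
  by (auto simp: b_prob_def pmf_le_1)

lemma first_b_prob_nonneg: "0 \<le> first_b_prob \<sigma> n"
  unfolding first_b_prob_def using b_prob_bounds
  by (intro mult_nonneg_nonneg prod_nonneg) auto

section \<open>Hitting probabilities under a fixed strategy\<close>

context
  fixes \<sigma> :: "(state, action) strategy"
  assumes strategy: "is_strategy example_mdp \<sigma>"
begin

text \<open>The value \<open>j = Suc n\<close> stands for a prefix in which \<open>b\<close> has not
  been chosen yet.\<close>

lemma unhit_prefix_cases:
  assumes supp: "\<And>n. \<omega> n \<in> set_pmf (step_pmf example_mdp St_x \<sigma> n \<omega>)"
    and "\<forall>i<Suc n. fst (\<omega> i) \<noteq> St_star"
  shows "\<exists>j\<le>Suc n. \<forall>i<Suc n. \<omega> i = unhit_play j i"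
  using assms(2)
proof (induction n)
  case 0
  have "fst (\<omega> 0) = St_x"
    using supp[of 0] by auto
  moreover have "snd (\<omega> 0) \<in> acts example_mdp (fst (\<omega> 0))"
    using history_of_supported_play[OF strategy supp] by blast
  ultimately have "\<omega> 0 = unhit_play 0 0 \<or> \<omega> 0 = unhit_play 1 0"
    by (cases "\<omega> 0") (auto simp: example_mdp_def unhit_play_def)
  then show ?case by fastforce
next
  case (Suc n)
  then obtain j where j: "j \<le> Suc n" and eq: "\<forall>i<Suc n. \<omega> i = unhit_play j i"
    by auto
  obtain u v where uv: "\<omega> (Suc n) = (u, v)" by fastforce
  have u: "u \<noteq> St_star"
    using Suc.prems uv by auto
  have v: "v \<in> example_acts u"
    using history_of_supported_play[OF strategy supp, of "Suc n"] uv by (simp add: example_mdp_def)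
  have "u \<in> set_pmf (example_transition (fst (\<omega> n)) (snd (\<omega> n)))"
    using supp[of "Suc n"] uv by (auto simp: example_mdp_def)
  then have u': "u \<in> set_pmf (example_transition (fst (unhit_play j n)) (snd (unhit_play j n)))"
    using eq by simp
  show ?case
  proof (cases "j = Suc n")
    case True
    \<comment> \<open>Only \<open>a\<close> so far, so play is still in \<open>x\<close>: choosing
      \<open>b\<close> now keeps \<open>j\<close>, choosing \<open>a\<close> raises it by
      one.\<close>
    then have "u = St_x"
      using u' u by (auto simp: unhit_play_def)
    then have "\<omega> (Suc n) = unhit_play (Suc n) (Suc n) \<or> \<omega> (Suc n) = unhit_play (Suc (Suc n)) (Suc n)"
      using v uv by (auto simp: unhit_play_def)
    moreover have "unhit_play (Suc (Suc n)) i = unhit_play (Suc n) i" if "i < Suc n" for i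
      using that by (simp add: unhit_play_def)
    ultimately show ?thesis
      using eq True by (metis le_SucI less_Suc_eq order_refl)
  next
    case False
    then have "j \<le> n" using j by simp
    \<comment> \<open>After \<open>b\<close>, both the next non-target state and its action are
      unique.\<close>
    then have "u = fst (unhit_play j (Suc n)) \<and> u \<noteq> St_x"
      using u' u by (auto simp: unhit_play_def split: if_splits)
    then have "\<omega> (Suc n) = unhit_play j (Suc n)"
      using v uv \<open>j \<le> n\<close> by (auto simp: unhit_play_def split: if_splits)
    then show ?thesis
      using eq j by (metis le_SucI less_Suc_eq)
  qed
qed

lemma map_unhit_play: "n \<le> j \<Longrightarrow> map (unhit_play j) [0..<n] = replicate n (St_x, Act_a)"
  by (rule nth_equalityI) (auto simp: unhit_play_def)

lemma pmf_strategy_unhit_play: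
  "pmf (\<sigma> (map (unhit_play j) [0..<n]) (fst (unhit_play j n))) (snd (unhit_play j n)) =
     (if n < j then 1 - b_prob \<sigma> n else if n = j then b_prob \<sigma> n else 1)"
proof -
  let ?p = "\<sigma> (map (unhit_play j) [0..<n]) (fst (unhit_play j n))"
  have supp: "set_pmf ?p \<subseteq> example_acts (fst (unhit_play j n))"
    using history_unhit_play[of j n] strategy by (auto simp: is_strategy_def example_mdp_def)
  have "(\<Sum>a\<in>example_acts (fst (unhit_play j n)). pmf ?p a) = 1"
    using supp by (intro sum_pmf_eq_1) (auto simp: unhit_play_def)
  then show ?thesis
    by (auto simp: b_prob_def map_unhit_play unhit_play_def split: if_splits)
qed

text \<open>Each \<open>a\<close> or \<open>e\<close> contributes a factor 1/2. The step after
  \<open>b\<close> contributes 1/4 and the step after \<open>d\<close> contributes 1, so the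
  deviation from \<open>1 / 2 ^ n\<close> is a halving visible only at
  \<open>n = Suc j\<close>.\<close>

lemma measure_unhit_cylinder:
  "measure (play_measure example_mdp St_x \<sigma>) {\<omega>. \<forall>i<Suc n. \<omega> i = unhit_play j i} =
     (if n < j then \<Prod>i<Suc n. 1 - b_prob \<sigma> i
      else if n = Suc j then first_b_prob \<sigma> j / 2 else first_b_prob \<sigma> j) / 2 ^ n"
proof (induction n)
  case 0
  have "pmf (step_pmf example_mdp St_x \<sigma> 0 (unhit_play j)) (unhit_play j 0) =
      pmf (\<sigma> [] St_x) (snd (unhit_play j 0))"
    by (auto simp: pmf_map_inj' inj_on_def unhit_play_def)
  also have "\<dots> = (if 0 < j then 1 - b_prob \<sigma> 0 else b_prob \<sigma> 0)"
    using pmf_strategy_unhit_play[of j 0] by (auto simp: unhit_play_def)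
  finally show ?case
    by (subst measure_cylinder_Suc, subst measure_cylinder_0) (auto simp: first_b_prob_def)
next
  case (Suc n)
  have "pmf (step_pmf example_mdp St_x \<sigma> (Suc n) (unhit_play j)) (unhit_play j (Suc n)) =
      pmf (example_transition (fst (unhit_play j n)) (snd (unhit_play j n))) (fst (unhit_play j (Suc n))) *
        (if Suc n < j then 1 - b_prob \<sigma> (Suc n) else if Suc n = j then b_prob \<sigma> (Suc n) else 1)"
    using pmf_step_pmf_Suc[of example_mdp St_x \<sigma> n "unhit_play j" "fst (unhit_play j (Suc n))"
        "snd (unhit_play j (Suc n))"]
    by (simp add: pmf_strategy_unhit_play example_mdp_def del: upt_Suc)
  also have "pmf (example_transition (fst (unhit_play j n)) (snd (unhit_play j n)))
      (fst (unhit_play j (Suc n))) = (if n = j then 1/4 else if n = Suc j then 1 else 1/2)"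
    by (simp add: unhit_play_def del: example_transition.simps)
  finally show ?case
    by (subst measure_cylinder_Suc, subst Suc.IH) (auto simp: first_b_prob_def le_Suc_eq not_less)
qed

lemma measure_hitting_time_le:
  "measure (play_measure example_mdp St_x \<sigma>) {\<omega>. hitting_time example_mdp \<omega> \<le> enat (n + 2)} =
     1 - (1 - first_b_prob \<sigma> n / 2) / 2 ^ Suc n"
proof -
  let ?P = "play_measure example_mdp St_x \<sigma>"
  let ?H = "{\<omega>. hitting_time example_mdp \<omega> \<le> enat (n + 2)}"
  let ?C = "\<lambda>j. {\<omega>. \<forall>i<Suc (Suc n). \<omega> i = unhit_play j i}"
  interpret P: prob_space ?P by (rule prob_space_play_measure)
  have target: "target example_mdp = St_star" by (simp add: example_mdp_def)
  have no_star: "fst (unhit_play j i) \<noteq> St_star" for i j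
    by (simp add: unhit_play_def)
  have "AE \<omega> in ?P. \<omega> \<in> UNIV - ?H \<longleftrightarrow> \<omega> \<in> (\<Union>j\<le>n + 2. ?C j)"
    using AE_step_support[of example_mdp St_x \<sigma>]
  proof eventually_elim
    case (elim \<omega>)
    then show ?case
      using unhit_prefix_cases[of \<omega> "Suc n"] no_star
      by (fastforce simp: hitting_time_le_iff target)
  qed
  moreover have "UNIV - ?H \<in> sets ?P"
    using sets.compl_sets[OF sets_hitting_time_le[of example_mdp "n + 2" St_x \<sigma>]]
    by (simp del: sets_play_measure)
  ultimately have "measure ?P (UNIV - ?H) = measure ?P (\<Union>j\<le>n + 2. ?C j)"
    by (intro P.finite_measure_eq_AE sets.finite_UN sets_cylinder) auto
  also have "\<dots> = (\<Sum>j\<le>n + 2. measure ?P (?C j))"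
  proof (rule P.finite_measure_finite_Union)
    show "disjoint_family_on ?C {..n + 2}"
      unfolding disjoint_family_on_def
    proof (intro ballI impI)
      fix j k assume "j \<in> {..n + 2}" "k \<in> {..n + 2}" "j \<noteq> k"
      \<comment> \<open>At the smaller index one play takes \<open>b\<close> while the other still
        takes \<open>a\<close>.\<close>
      then have "min j k < Suc (Suc n)" "unhit_play j (min j k) \<noteq> unhit_play k (min j k)"
        by (auto simp: unhit_play_def min_def)
      then show "?C j \<inter> ?C k = {}"
        by (auto simp del: min_less_iff_conj)
    qed
  qed (auto intro: sets_cylinder simp del: sets_play_measure)
  also have "\<dots> = ((\<Sum>j<n. first_b_prob \<sigma> j) + first_b_prob \<sigma> n / 2 + first_b_prob \<sigma> (Suc n)
      + (\<Prod>i<Suc (Suc n). 1 - b_prob \<sigma> i)) / 2 ^ Suc n"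
  proof -
    have "{..n + 2} = insert (n + 2) (insert (Suc n) (insert n {..<n}))" by auto
    then show ?thesis
      by (simp add: measure_unhit_cylinder add_divide_distrib sum_divide_distrib
          del: prod.lessThan_Suc power_Suc)
  qed
  \<comment> \<open>With full weights the numerator would telescope to 1; only half of the weight at
    \<open>n\<close> is missing.\<close>
  also have "\<dots> = (1 - first_b_prob \<sigma> n / 2) / 2 ^ Suc n"
    using sum_first_b_prob[of \<sigma> "Suc (Suc n)"] by simp
  finally have "measure ?P (UNIV - ?H) = (1 - first_b_prob \<sigma> n / 2) / 2 ^ Suc n" .
  then show ?thesis
    using P.prob_compl[of ?H] sets_hitting_time_le[of example_mdp "n + 2" St_x \<sigma>] by simp
qed

end

section \<open>Construction of an overtaking strategy\<close>

lemma ex_eventually_greater_first_success_probs: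
  fixes r :: "nat \<Rightarrow> real"
  assumes nonneg: "\<And>n. 0 \<le> r n" and sum_le: "\<And>n. (\<Sum>i<n. r i) \<le> 1"
  obtains q :: "nat \<Rightarrow> real" and N
  where "\<And>n. 0 \<le> q n" "\<And>n. q n \<le> 1" "\<And>n. N \<le> n \<Longrightarrow> r n < q n * (\<Prod>i<n. 1 - q i)"
proof -
  have "summable r"
    by (rule summableI_nonneg_bounded) (use assms in auto)
  from suminf_exist_split[OF _ this, of "1/2"] obtain N where N: "norm (\<Sum>i. r (i + N)) < 1/2"
    by auto
  \<comment> \<open>The tail of \<open>r\<close> from \<open>N\<close> on sums to less than 1/2 and
    the added geometric terms to at most 1/4. The total thus stays below 1, with a strict gain at
    every \<open>n \<ge> N\<close>.\<close>
  define r' where "r' n = (if n < N then 0 else r n + (1/2) ^ (n + 3))" for n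
  have r'_nonneg: "0 \<le> r' n" for n
    using nonneg by (simp add: r'_def)
  have sum_r': "(\<Sum>i<n. r' i) \<le> 3/4" for n
  proof -
    have "(\<Sum>i<n. r' i) \<le> (\<Sum>i<n. (if i < N then 0 else r i)) + (\<Sum>i<n. (1/2) ^ (i + 3))"
      unfolding sum.distrib[symmetric] by (intro sum_mono) (auto simp: r'_def)
    also have "(\<Sum>i<n. (if i < N then 0 else r i)) \<le> 1/2"
    proof -
      have "(\<Sum>i<n. (if i < N then 0 else r i)) \<le> (\<Sum>i<n + N. (if i < N then 0 else r i))"
        using nonneg by (intro sum_mono2) auto
      also have "\<dots> = (\<Sum>i<n. r (i + N))"
        by (induction n) auto
      also have "\<dots> \<le> (\<Sum>i. r (i + N))"
        using \<open>summable r\<close> nonneg by (intro sum_le_suminf) (auto simp: summable_iff_shift)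
      finally show ?thesis using N by simp
    qed
    also have "(\<Sum>i<n. (1/2) ^ (i + 3)) = (1 - (1/2) ^ n) / (4::real)"
      by (induction n) (auto simp: power_add field_simps)
    also have "\<dots> \<le> 1/4" by simp
    finally show ?thesis by simp
  qed
  \<comment> \<open>The hazard rate of \<open>r'\<close>: success at \<open>n\<close> conditional on
    no earlier success. The denominators are at least 1/4.\<close>
  define q where "q n = r' n / (1 - (\<Sum>i<n. r' i))" for n
  have pos: "0 < 1 - (\<Sum>i<n. r' i)" for n
    using sum_r'[of n] by simp
  have prod_q: "(\<Prod>i<n. 1 - q i) = 1 - (\<Sum>i<n. r' i)" for n
  proof (induction n)
    case (Suc n)
    then show ?case
      using pos[of n] by (simp add: q_def right_diff_distrib)
  qed simp
  show ?thesis
  proof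
    show "0 \<le> q n" for n
      using r'_nonneg[of n] pos[of n] by (simp add: q_def)
    \<comment> \<open>This says that the partial sum including \<open>r' n\<close> is still at most
      1.\<close>
    show "q n \<le> 1" for n
      using pos[of n] pos[of "Suc n"] by (simp add: q_def)
    show "r n < q n * (\<Prod>i<n. 1 - q i)" if "N \<le> n" for n
      using pos[of n] that unfolding prod_q by (simp add: q_def r'_def)
  qed
qed

text \<open>The length of \<open>h\<close> suffices in \<open>x\<close>, since a history ending in
  \<open>x\<close> consists of copies of \<open>(St_x, Act_a)\<close> only.\<close>

definition b_strategy :: "(nat \<Rightarrow> real) \<Rightarrow> (state, action) strategy" where
  "b_strategy q h s = (case s of
      St_x \<Rightarrow> map_pmf (\<lambda>c. if c then Act_b else Act_a) (bernoulli_pmf (q (length h)))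
    | St_y \<Rightarrow> return_pmf Act_d | St_z \<Rightarrow> return_pmf Act_e | St_star \<Rightarrow> return_pmf Act_stay)"

lemma is_strategy_b_strategy: "is_strategy example_mdp (b_strategy q)"
  by (auto simp: is_strategy_def b_strategy_def example_mdp_def split: state.splits)

lemma b_prob_b_strategy:
  assumes "0 \<le> q n" "q n \<le> 1"
  shows "b_prob (b_strategy q) n = q n"
proof -
  have "(\<lambda>c. if c then Act_b else Act_a) -` {Act_b} = {True}"
    by (auto split: if_splits)
  then show ?thesis
    using assms by (simp add: b_prob_def b_strategy_def pmf_map measure_pmf_single)
qed

theorem claim8:
  shows "\<not> (\<exists>\<sigma>. overtaking_optimal example_mdp St_x \<sigma>)"
proof
  assume "\<exists>\<sigma>. overtaking_optimal example_mdp St_x \<sigma>"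
  then obtain \<sigma> where \<sigma>: "is_strategy example_mdp \<sigma>"
    and optimal: "\<And>\<sigma>'. is_strategy example_mdp \<sigma>' \<Longrightarrow> \<not> overtakes example_mdp St_x \<sigma>' \<sigma>"
    by (auto simp: overtaking_optimal_def)
  have "(\<Sum>i<n. first_b_prob \<sigma> i) \<le> 1" for n
    using prod_nonneg[of "{..<n}" "\<lambda>i. 1 - b_prob \<sigma> i"]
    by (simp add: sum_first_b_prob b_prob_bounds)
  then obtain q N where q: "\<And>n. 0 \<le> q n" "\<And>n. q n \<le> 1"
    and greater: "\<And>n. N \<le> n \<Longrightarrow> first_b_prob \<sigma> n < q n * (\<Prod>i<n. 1 - q i)"
    using ex_eventually_greater_first_success_probs[of "first_b_prob \<sigma>"] first_b_prob_nonneg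
    by blast
  have first_b: "first_b_prob (b_strategy q) n = q n * (\<Prod>i<n. 1 - q i)" for n
    using q by (simp add: first_b_prob_def b_prob_b_strategy)
  have "overtakes example_mdp St_x (b_strategy q) \<sigma>"
    unfolding overtakes_def
  proof (intro exI allI impI)
    \<comment> \<open>The shift by 2 matches the horizon \<open>n + 2\<close> in
      \<open>measure_hitting_time_le\<close>, where a larger first-\<open>b\<close> weight at
      \<open>n\<close> means a larger hitting probability.\<close>
    fix t assume "N + 2 \<le> t"
    then obtain n where n: "t = n + 2" "N \<le> n"
      using that[of "t - 2"] by simp
    show "measure (play_measure example_mdp St_x \<sigma>) {\<omega>. hitting_time example_mdp \<omega> \<le> enat t}
        < measure (play_measure example_mdp St_x (b_strategy q)) {\<omega>. hitting_time example_mdp \<omega> \<le> enat t}"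
      unfolding n measure_hitting_time_le[OF \<sigma>] measure_hitting_time_le[OF is_strategy_b_strategy]
      using greater[OF n(2)] by (simp add: first_b divide_strict_right_mono)
  qed
  then show False
    using optimal is_strategy_b_strategy by blast
qed

end
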